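(* For every integer $n\ge1$, the Bernoulli polynomials satisfy \[ B_n(x)=\sum_{p=1}^{n}\binom{n+1}{p+1}(-1)^p\,B_n^{(-p)}(-px). \]
   Context: The Bernoulli polynomials are defined by $\sum_{n\ge0}\frac{B_n(x)}{n!}z^n=\frac{ze^{zx}}{e^z-1}$. For an integer $p$, the higher-order Bernoulli polynomials $B_n^{(p)}(x)$ are defined by $\sum_{n\ge0}\frac{B_n^{(p)}(x)}{n!}z^n=e^{zx}\left(\frac{z}{e^z-1}\right)^p$. *)

theory Defs
  imports "HOL-Computational_Algebra.Formal_Power_Series"
begin

text \<open>
  Both families are given by the coefficients of their exponential generating functions, taken as
  formal power series in \<open>z\<close> with \<open>x\<close> ranging over a field of characteristic 0.
\<close>

definition bernoulli_poly :: "nat \<Rightarrow> 'a::field_char_0 \<Rightarrow> 'a" where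
  "bernoulli_poly n x = fact n * fps_nth (fps_X * fps_exp x / (fps_exp 1 - 1)) n"

definition bernoulli_poly_ho :: "int \<Rightarrow> nat \<Rightarrow> 'a::field_char_0 \<Rightarrow> 'a" where
  "bernoulli_poly_ho p n x =
     fact n * fps_nth (fps_exp x * (fps_X / (fps_exp 1 - 1)) powi p) n"

text \<open>
  Division of formal power series is a total function, so we record that the quotients above are
  the intended ones, and that \<open>z / (e\<^sup>z - 1)\<close> is invertible, so that this also holds for its negative powers.
\<close>

lemma subdegree_fps_exp_minus_1: "subdegree (fps_exp (1::'a::field_char_0) - 1) = 1"
  by (rule subdegreeI) auto

lemma bernoulli_quotient:
  "fps_X / (fps_exp 1 - 1) * (fps_exp 1 - 1) = (fps_X :: 'a::field_char_0 fps)"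
  "fps_nth (fps_X / (fps_exp 1 - 1)) 0 = (1 :: 'a::field_char_0)"
proof -
  have "fps_exp (1::'a) - 1 \<noteq> 0"
    using subdegree_fps_exp_minus_1[where ?'a = 'a] by (metis subdegree_0 zero_neq_one)
  then have "(fps_exp 1 - 1) dvd (fps_X :: 'a fps)"
    using subdegree_fps_exp_minus_1[where ?'a = 'a] by (subst fps_dvd_iff) simp_all
  then show *: "fps_X / (fps_exp 1 - 1) * (fps_exp 1 - 1) = (fps_X :: 'a fps)"
    by simp
  have "fps_nth (fps_X / (fps_exp 1 - 1) * (fps_exp 1 - 1)) 1 = (1::'a)"
    by (subst *) simp
  then show "fps_nth (fps_X / (fps_exp 1 - 1)) 0 = (1::'a)"
    by (simp add: fps_mult_nth)
qed

lemma bernoulli_poly_gf: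
  "Abs_fps (\<lambda>n. bernoulli_poly n x / fact n) * (fps_exp 1 - 1) = fps_X * fps_exp x"
proof -
  have "(fps_exp 1 - 1 :: 'a fps) dvd fps_X * fps_exp x"
    by (metis bernoulli_quotient(1) dvd_mult2 dvd_triv_right)
  moreover have "Abs_fps (\<lambda>n. bernoulli_poly n x / fact n) = fps_X * fps_exp x / (fps_exp 1 - 1)"
    by (rule fps_ext) (simp add: bernoulli_poly_def)
  ultimately show ?thesis
    by simp
qed

lemma bernoulli_poly_ho_gf:
  "Abs_fps (\<lambda>n. bernoulli_poly_ho (int p) n x / fact n) * (fps_exp 1 - 1) ^ p
     = fps_exp x * fps_X ^ p"
  "Abs_fps (\<lambda>n. bernoulli_poly_ho (- int p) n x / fact n) * fps_X ^ p
     = fps_exp x * (fps_exp 1 - 1) ^ p"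
proof -
  let ?q = "fps_X / (fps_exp 1 - 1) :: 'a fps"
  have X: "(fps_X :: 'a fps) ^ p = ?q ^ p * (fps_exp 1 - 1) ^ p"
    by (metis bernoulli_quotient(1) power_mult_distrib)
  have gf: "Abs_fps (\<lambda>n. bernoulli_poly_ho k n x / fact n) = fps_exp x * ?q powi k" for k
    by (rule fps_ext) (simp add: bernoulli_poly_ho_def)
  show "Abs_fps (\<lambda>n. bernoulli_poly_ho (int p) n x / fact n) * (fps_exp 1 - 1) ^ p
     = fps_exp x * fps_X ^ p"
    unfolding gf X by (simp add: power_int_def mult_ac)
  have "?q powi (- int p) = inverse ?q ^ p"
    by (cases "p = 0") (auto simp: power_int_def)
  moreover have "inverse ?q ^ p * ?q ^ p = 1"
    by (metis bernoulli_quotient(2) inverse_mult_eq_1 one_neq_zero power_mult_distrib power_one)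
  ultimately show "Abs_fps (\<lambda>n. bernoulli_poly_ho (- int p) n x / fact n) * fps_X ^ p
     = fps_exp x * (fps_exp 1 - 1) ^ p"
    unfolding gf X by (metis (no_types, lifting) mult.assoc mult.right_neutral)
qed

end

theory Submission
  imports Defs
begin

text \<open>
  Let \<open>W = e\<^sup>-\<^sup>z\<^sup>x (e\<^sup>z - 1) / z\<close>, so that \<open>B\<^sub>n(x) / n!\<close> and \<open>B\<^sub>n\<^sup>(\<^sup>-\<^sup>p\<^sup>)(-px) / n!\<close> are the coefficients of
  \<open>z\<^sup>n\<close> in \<open>1/W\<close> and \<open>W\<^sup>p\<close>. Since \<open>W\<close> has constant term 1, \<open>(1 - W)\<^sup>n\<^sup>+\<^sup>1\<close> vanishes to order \<open>n + 1\<close>,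
  so \<open>1/W\<close> and \<open>(1 - (1 - W)\<^sup>n\<^sup>+\<^sup>1) / W\<close> have the same coefficient at \<open>z\<^sup>n\<close>; the binomial theorem
  expands the latter into powers \<open>W\<^sup>p\<close> with \<open>0 \<le> p \<le> n\<close>, and the term \<open>p = 0\<close> is constant in \<open>z\<close>.
\<close>

text \<open>The term k = 0 of the binomial expansion cancels the 1; each other term contains a
  factor \<open>w\<close>, and pulling it out shifts the index by one.\<close>

lemma one_minus_one_minus_power_Suc:
  fixes w :: "'a::comm_ring_1"
  shows "1 - (1 - w) ^ Suc n = w * (\<Sum>p\<le>n. of_nat (Suc n choose Suc p) * (-1) ^ p * w ^ p)"
proof -
  have "(1 - w) ^ Suc n = (- w + 1) ^ Suc n"
    by simp
  also have "\<dots> = (\<Sum>k\<le>Suc n. of_nat (Suc n choose k) * (- w) ^ k)"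
    by (subst binomial_ring) simp
  also have "\<dots> = 1 + (\<Sum>p\<le>n. of_nat (Suc n choose Suc p) * (- w) ^ Suc p)"
    by (subst sum.atMost_Suc_shift) simp
  also have "(\<Sum>p\<le>n. of_nat (Suc n choose Suc p) * (- w) ^ Suc p)
      = - (w * (\<Sum>p\<le>n. of_nat (Suc n choose Suc p) * (-1) ^ p * w ^ p))"
    unfolding sum_distrib_left sum_negf[symmetric]
    by (rule sum.cong[OF refl], subst power_minus) (simp add: mult_ac)
  finally show ?thesis
    by simp
qed

lemma fps_nth_inverse_binomial:
  fixes w :: "'a::field fps"
  assumes "fps_nth w 0 = 1"
  shows "fps_nth (inverse w) n
    = (\<Sum>p\<le>n. of_nat (Suc n choose Suc p) * (-1) ^ p * fps_nth (w ^ p) n)"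
proof -
  let ?S = "\<Sum>p\<le>n. of_nat (Suc n choose Suc p) * (-1) ^ p * w ^ p"
  have inv: "inverse w * w = 1"
    using assms by (simp add: inverse_mult_eq_1)
  have "inverse w - inverse w * (1 - w) ^ Suc n = inverse w * (1 - (1 - w) ^ Suc n)"
    by (simp only: right_diff_distrib mult_1_right)
  also have "\<dots> = ?S"
    by (simp only: one_minus_one_minus_power_Suc mult.assoc[symmetric] inv mult_1_left)
  finally have eq: "inverse w = ?S + inverse w * (1 - w) ^ Suc n"
    by (simp only: diff_eq_eq)
  have "fps_nth ((1 - w) ^ Suc n) k = 0" if "k \<le> n" for k
    using startsby_zero_power_prefix[of "1 - w" "Suc n"] assms that by auto
  then have "fps_nth (inverse w * (1 - w) ^ Suc n) n = 0"
    unfolding fps_mult_nth by (intro sum.neutral) auto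
  \<comment> \<open>The scalar is a series on the left and a field element on the right; as a
    constant series it passes through \<open>fps_nth\<close>.\<close>
  moreover have "fps_nth (of_nat a * (-1) ^ p * u) n = of_nat a * (-1) ^ p * fps_nth u n"
    for a p and u :: "'a fps"
  proof -
    have "of_nat a * (-1) ^ p = fps_const (of_nat a * (-1) ^ p :: 'a)"
      by (cases "even p") (simp_all add: fps_of_nat[symmetric])
    then show ?thesis
      by (metis fps_mult_left_const_nth)
  qed
  ultimately show ?thesis
    by (subst eq) (simp only: fps_add_nth fps_sum_nth add_0_right)
qed

theorem theorem15:
  fixes n :: nat and x :: "'a::field_char_0"
  assumes "n \<ge> 1"
  shows "bernoulli_poly n x =
    (\<Sum>p = 1..n. of_nat ((n + 1) choose (p + 1)) * (-1) ^ p *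
      bernoulli_poly_ho (- int p) n (- of_nat p * x))"
proof -
  let ?q = "fps_X / (fps_exp 1 - 1) :: 'a fps"
  let ?w = "fps_exp (- x) * inverse ?q"
  \<comment> \<open>Exact divisibility lets \<open>fps_exp x\<close> leave the total
    quotient.\<close>
  have "(fps_exp 1 - 1 :: 'a fps) dvd fps_X"
    by (metis bernoulli_quotient(1) dvd_triv_right)
  then have "fps_X * fps_exp x / (fps_exp 1 - 1) = fps_exp x * ?q"
    by (metis div_mult_swap mult.commute)
  also have "\<dots> = inverse ?w"
    by (simp add: fps_inverse_mult bernoulli_quotient(2) fps_exp_neg[symmetric])
  finally have B: "bernoulli_poly n x = fact n * fps_nth (inverse ?w) n"
    by (simp add: bernoulli_poly_def)
  have "?w ^ p = fps_exp (- of_nat p * x) * ?q powi (- int p)" for p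
  proof -
    have "?q powi (- int p) = inverse ?q ^ p"
      by (cases "p = 0") (auto simp: power_int_def)
    then show ?thesis
      by (simp add: power_mult_distrib fps_exp_power_mult)
  qed
  then have H: "bernoulli_poly_ho (- int p) n (- of_nat p * x) = fact n * fps_nth (?w ^ p) n" for p
    by (simp add: bernoulli_poly_ho_def)
  have "fps_nth ?w 0 = 1"
    by (simp add: bernoulli_quotient(2))
  then have "fps_nth (inverse ?w) n
      = (\<Sum>p\<le>n. of_nat (Suc n choose Suc p) * (-1) ^ p * fps_nth (?w ^ p) n)"
    by (rule fps_nth_inverse_binomial)
  also have "\<dots> = (\<Sum>p = 1..n. of_nat (Suc n choose Suc p) * (-1) ^ p * fps_nth (?w ^ p) n)"
  proof (rule sum.mono_neutral_right)
    \<comment> \<open>Only p = 0 is dropped: \<open>?w ^ 0 = 1\<close> has zero coefficient at n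
      since n \<ge> 1.\<close>
    show "\<forall>p\<in>{..n} - {1..n}. of_nat (Suc n choose Suc p) * (-1) ^ p * fps_nth (?w ^ p) n = 0"
      using assms by (auto simp: not_le)
  qed auto
  finally show ?thesis
    unfolding B H by (simp add: sum_distrib_left mult_ac)
qed

end
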